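(* Let $f\colon(0,+\infty)\to\mathbb{R}$ be given by $f(x)=\ln x$ for $x\in(0,1]$ and $f(x)=x-1$ for $x\in(1,\infty)$. Then the quasi-arithmetic mean $\mathscr{A}^{[f]}$ on $(0,+\infty)$ is a weak-Hardy mean but is not a Hardy mean.
   Context: For an interval $I$ and a continuous, strictly monotone function $f\colon I\to\mathbb{R}$, the quasi-arithmetic mean $\mathscr{A}^{[f]}$ on $I$ is $\mathscr{A}^{[f]}(a_1,\dots,a_n)=f^{-1}\big(\tfrac{f(a_1)+\cdots+f(a_n)}{n}\big)$ for $n\in\mathbb{N}$ and $(a_1,\dots,a_n)\in I^n$. For an interval $I\subset[0,+\infty)$, $\ell_1(I)$ denotes the set of summable sequences with all terms in $I$. A mean $\mathscr{M}\colon\bigcup_{n=1}^\infty I^n\to I$ on $I$ is a Hardy mean if there is a finite constant $C$ such that $\sum_{n=1}^\infty \mathscr{M}(a_1,\dots,a_n)\le C\sum_{n=1}^\infty a_n$ for all $a\in\ell_1(I)$; it is a weak-Hardy mean if $\sum_{n=1}^\infty \mathscr{M}(a_1,\dots,a_n)<+\infty$ for all $a\in\ell_1(I)$. *)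

theory Defs
  imports "HOL-Analysis.Analysis"
begin

text \<open>
  A mean on \<open>I\<close>, i.e. a function on the union of the powers \<open>I\<^sup>n\<close> for \<open>n \<ge> 1\<close>, is a function on
  lists; only its values on nonempty lists with entries in \<open>I\<close> are relevant.
\<close>

definition mean_on :: "real set \<Rightarrow> (real list \<Rightarrow> real) \<Rightarrow> bool" where
  "mean_on I M \<longleftrightarrow>
     (\<forall>xs. xs \<noteq> [] \<and> set xs \<subseteq> I \<longrightarrow>
        M xs \<in> I \<and> Min (set xs) \<le> M xs \<and> M xs \<le> Max (set xs))"

text \<open>Meaningful when \<open>I\<close> is an interval and \<open>f\<close> is continuous and strictly monotone on \<open>I\<close>.\<close>

definition quasi_arithmetic_mean :: "real set \<Rightarrow> (real \<Rightarrow> real) \<Rightarrow> real list \<Rightarrow> real" where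
  "quasi_arithmetic_mean I f xs =
     the_inv_into I f ((\<Sum>x\<leftarrow>xs. f x) / real (length xs))"

definition ell1 :: "real set \<Rightarrow> (nat \<Rightarrow> real) set" where
  "ell1 I = {a. range a \<subseteq> I \<and> summable a}"

text \<open>
  The following notions are meant for intervals \<open>I \<subseteq> {0..}\<close>. Sequences are indexed from 0, so
  that \<open>map a [0..<Suc n]\<close> lists the first \<open>n + 1\<close> terms. Since \<^const>\<open>suminf\<close> is only
  meaningful for convergent series, finiteness of the sum of means is stated as
  \<^const>\<open>summable\<close>.
\<close>

definition hardy_mean :: "real set \<Rightarrow> (real list \<Rightarrow> real) \<Rightarrow> bool" where
  "hardy_mean I M \<longleftrightarrow>
     mean_on I M \<and>
     (\<exists>C::real. \<forall>a\<in>ell1 I.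
        summable (\<lambda>n. M (map a [0..<Suc n])) \<and>
        (\<Sum>n. M (map a [0..<Suc n])) \<le> C * (\<Sum>n. a n))"

definition weak_hardy_mean :: "real set \<Rightarrow> (real list \<Rightarrow> real) \<Rightarrow> bool" where
  "weak_hardy_mean I M \<longleftrightarrow>
     mean_on I M \<and> (\<forall>a\<in>ell1 I. summable (\<lambda>n. M (map a [0..<Suc n])))"

text \<open>The generator under consideration is admissible for \<^const>\<open>quasi_arithmetic_mean\<close>.\<close>

lemma generator_admissible:
  fixes f :: "real \<Rightarrow> real"
  assumes ln: "\<And>x. 0 < x \<Longrightarrow> x \<le> 1 \<Longrightarrow> f x = ln x"
    and lin: "\<And>x. 1 < x \<Longrightarrow> f x = x - 1"
  shows "continuous_on {0<..} f" and "strict_mono_on {0<..} f"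
proof -
  have "continuous_on ({0<..1} \<union> {1..}) (\<lambda>x::real. if x \<le> 1 then ln x else x - 1)"
  proof (rule continuous_on_cases_local)
    show "closedin (top_of_set ({0<..1} \<union> {1..})) {0<..(1::real)}"
      unfolding closedin_closed by (rule exI[of _ "{..1}"]) auto
    show "closedin (top_of_set ({0<..1} \<union> {1..})) {(1::real)..}"
      unfolding closedin_closed by (rule exI[of _ "{1..}"]) auto
  qed (auto intro!: continuous_intros)
  moreover have "{0<..1} \<union> {1..} = {0::real<..}" by auto
  ultimately show "continuous_on {0<..} f"
    using continuous_on_cong[of "{0<..}" "{0<..}" "\<lambda>x. if x \<le> 1 then ln x else x - 1" f]
    by (auto simp: ln lin)
  show "strict_mono_on {0<..} f"
  proof (rule strict_mono_onI)
    fix x y :: real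
    assume "x \<in> {0<..}" "y \<in> {0<..}" "x < y"
    moreover have "ln x < y - 1" if "0 < x" "x \<le> 1" "1 < y"
      using that ln_le_zero_iff[of x] by linarith
    ultimately show "f x < f y"
      by (cases "x \<le> 1"; cases "y \<le> 1") (auto simp: ln lin)
  qed
qed

end

(* The function f satisfies f x \<le> ln x + x and x \<le> exp (f x), so the mean of the first terms of a
   summable sequence a is at most exp (\<Sum> a) times their geometric mean; Carleman's inequality
   therefore gives summability, with a bound that is not linear in \<Sum> a.
   That no linear bound exists is seen on N + 1 followed by N terms 1/e and a geometric tail:
   the sum is O(N), whereas the first N + 1 means are (N + 1) / k, with sum (N + 1) harm (N + 1). *)
theory Submission
  imports Defs
begin

text \<open>The average of the values of \<open>f\<close> lies between the values at the minimum and
  the maximum, so the intermediate value theorem gives it a preimage between them, and injectivity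
  identifies that preimage with \<open>the_inv_into\<close>. The last claim allows working with
  \<open>f\<close> of the mean instead of the inverse.\<close>

lemma quasi_arithmetic_mean_between:
  fixes f :: "real \<Rightarrow> real"
  assumes I: "is_interval I" and cont: "continuous_on I f" and mono: "strict_mono_on I f"
    and xs: "xs \<noteq> []" "set xs \<subseteq> I"
  shows "quasi_arithmetic_mean I f xs \<in> I"
    and "Min (set xs) \<le> quasi_arithmetic_mean I f xs"
    and "quasi_arithmetic_mean I f xs \<le> Max (set xs)"
    and "f (quasi_arithmetic_mean I f xs) = (\<Sum>x\<leftarrow>xs. f x) / real (length xs)"
proof -
  define y where "y = (\<Sum>x\<leftarrow>xs. f x) / real (length xs)"
  define m where "m = Min (set xs)"
  define M where "M = Max (set xs)"
  have mM: "m \<in> I" "M \<in> I" "m \<le> M"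
    using xs Min_in[of "set xs"] Max_in[of "set xs"] by (auto simp: m_def M_def)
  have bnd: "f m \<le> f x" "f x \<le> f M" if "x \<in> set xs" for x
  proof -
    have "x \<in> I" "m \<le> x" "x \<le> M" using that xs(2) by (auto simp: m_def M_def)
    thus "f m \<le> f x" "f x \<le> f M"
      using mM mono_onD[OF strict_mono_on_imp_mono_on[OF mono]] by blast+
  qed
  have len: "real (length xs) > 0" using xs by simp
  have "(\<Sum>x\<leftarrow>xs. f m) \<le> (\<Sum>x\<leftarrow>xs. f x)" "(\<Sum>x\<leftarrow>xs. f x) \<le> (\<Sum>x\<leftarrow>xs. f M)"
    using bnd by (auto intro!: sum_list_mono)
  hence "f m \<le> y" "y \<le> f M"
    using len by (auto simp: y_def sum_list_triv field_simps)
  moreover have sub: "{m..M} \<subseteq> I"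
    using mem_is_interval_1_I[OF I mM(1,2)] by auto
  ultimately obtain c where c: "m \<le> c" "c \<le> M" "f c = y"
    using IVT'[of f m y M] mM continuous_on_subset[OF cont sub] by auto
  have "c \<in> I" using c sub by auto
  hence "quasi_arithmetic_mean I f xs = c"
    unfolding quasi_arithmetic_mean_def
    using the_inv_into_f_eq[OF strict_mono_on_imp_inj_on[OF mono], of c y] c(3)
    by (simp add: y_def)
  thus "quasi_arithmetic_mean I f xs \<in> I"
    and "Min (set xs) \<le> quasi_arithmetic_mean I f xs"
    and "quasi_arithmetic_mean I f xs \<le> Max (set xs)"
    and "f (quasi_arithmetic_mean I f xs) = (\<Sum>x\<leftarrow>xs. f x) / real (length xs)"
    using c \<open>c \<in> I\<close> by (auto simp: m_def M_def y_def)
qed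

lemma mean_on_quasi_arithmetic_mean:
  fixes f :: "real \<Rightarrow> real"
  assumes "is_interval I" "continuous_on I f" "strict_mono_on I f"
  shows "mean_on I (quasi_arithmetic_mean I f)"
  using quasi_arithmetic_mean_between[OF assms] by (auto simp: mean_on_def)

text \<open>Logarithmic form of n! \<ge> ((n + 1) / e)^n, the source of the constant e in Carleman's
  inequality.\<close>

lemma sum_ln_ge: "real n * ln (real n + 1) - real n \<le> (\<Sum>k<n. ln (real k + 1))"
proof (induction n)
  case (Suc n)
  have "ln (real n + 2) - ln (real n + 1) \<le> 1 / (real n + 1)"
    using ln_diff_le[of "real n + 2" "real n + 1"] by simp
  hence "(real n + 1) * ln (real n + 2) - (real n + 1) * ln (real n + 1) \<le> 1"
    by (simp add: field_simps)
  thus ?case using Suc by (simp add: algebra_simps)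
qed simp

text \<open>Jensen's inequality for exp with equal weights, that is, AM-GM for the numbers
  \<open>exp (y k)\<close>.\<close>

lemma exp_mean_le_mean_exp:
  fixes y :: "'a \<Rightarrow> real"
  assumes "finite S" "S \<noteq> {}"
  shows "exp ((\<Sum>k\<in>S. y k) / real (card S)) \<le> (\<Sum>k\<in>S. exp (y k)) / real (card S)"
proof -
  have "exp (\<Sum>k\<in>S. (1 / real (card S)) *\<^sub>R y k) \<le> (\<Sum>k\<in>S. 1 / real (card S) * exp (y k))"
    using assms by (intro convex_on_sum[OF _ _ exp_convex]) auto
  thus ?thesis by (simp add: sum_divide_distrib)
qed

text \<open>The weights \<open>k + 1\<close> turn the geometric mean into a term whose series telescopes.\<close>

lemma geometric_mean_le:
  fixes a :: "nat \<Rightarrow> real"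
  assumes pos: "\<And>k. a k > 0"
  shows "exp ((\<Sum>k<Suc n. ln (a k)) / real (Suc n))
    \<le> exp 1 * ((\<Sum>k<Suc n. (real k + 1) * a k) / ((real n + 1) * (real n + 2)))"
proof -
  let ?N = "real (Suc n)"
  \<comment> \<open>The weights are compensated by ln (n + 1)!, whose lower bound yields the factor
    e / (n + 2) after exponentiation. AM-GM on the weighted terms then supplies the other factor 1 /
    (n + 1).\<close>
  have "(\<Sum>k<Suc n. ln (a k)) = (\<Sum>k<Suc n. ln ((real k + 1) * a k)) - (\<Sum>k<Suc n. ln (real k + 1))"
    using pos by (simp add: ln_mult_pos sum.distrib del: sum.lessThan_Suc)
  also have "\<dots> \<le> (\<Sum>k<Suc n. ln ((real k + 1) * a k)) - (?N * ln (?N + 1) - ?N)"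
    using sum_ln_ge[of "Suc n"] by linarith
  finally have "(\<Sum>k<Suc n. ln (a k)) / ?N
      \<le> ((\<Sum>k<Suc n. ln ((real k + 1) * a k)) - (?N * ln (?N + 1) - ?N)) / ?N"
    by (rule divide_right_mono) simp
  also have "\<dots> = (\<Sum>k<Suc n. ln ((real k + 1) * a k)) / ?N + 1 - ln (?N + 1)"
    by (simp add: divide_simps del: sum.lessThan_Suc)
  finally have "exp ((\<Sum>k<Suc n. ln (a k)) / ?N)
      \<le> exp ((\<Sum>k<Suc n. ln ((real k + 1) * a k)) / ?N + 1 - ln (?N + 1))"
    by simp
  also have "\<dots> = exp ((\<Sum>k<Suc n. ln ((real k + 1) * a k)) / ?N) * exp 1 / (?N + 1)"
    by (simp add: exp_add exp_diff del: sum.lessThan_Suc)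
  also have "\<dots> \<le> (\<Sum>k<Suc n. exp (ln ((real k + 1) * a k))) / ?N * exp 1 / (?N + 1)"
    using exp_mean_le_mean_exp[of "{..<Suc n}" "\<lambda>k. ln ((real k + 1) * a k)"]
    by (intro divide_right_mono mult_right_mono) (auto simp del: sum.lessThan_Suc)
  also have "(\<Sum>k<Suc n. exp (ln ((real k + 1) * a k))) = (\<Sum>k<Suc n. (real k + 1) * a k)"
    using pos by (intro sum.cong) (auto intro!: exp_ln mult_pos_pos)
  finally show ?thesis
    by (simp add: mult_ac add_ac del: sum.lessThan_Suc)
qed

text \<open>With S(n) the weighted sum over k < n, splitting 1 / ((n + 1) (n + 2)) into partial
  fractions turns each summand into a(n) + S(n) / (n + 1) - S(n + 1) / (n + 2).\<close>

lemma sum_weighted_mean_telescope: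
  fixes a :: "nat \<Rightarrow> real"
  shows "(\<Sum>n<N. (\<Sum>k<Suc n. (real k + 1) * a k) / ((real n + 1) * (real n + 2)))
    = (\<Sum>k<N. a k) - (\<Sum>k<N. (real k + 1) * a k) / (real N + 1)"
proof (induction N)
  case (Suc N)
  define T where "T = (\<Sum>k<N. (real k + 1) * a k)"
  define A where "A = a N"
  have "1 / ((real N + 1) * (real N + 2)) = 1 / (real N + 1) - 1 / (real N + 2)"
    by (simp add: divide_simps)
  hence "(T + (real N + 1) * A) / ((real N + 1) * (real N + 2))
      = (T + (real N + 1) * A) * (1 / (real N + 1) - 1 / (real N + 2))"
    by (metis mult.right_neutral times_divide_eq_right)
  also have "\<dots> = T / (real N + 1) + A - (T + (real N + 1) * A) / (real N + 2)"
    using nonzero_mult_div_cancel_left[of "real N + 1" A]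
    by (simp only: right_diff_distrib times_divide_eq_right mult_1_right)
      (simp only: add_divide_distrib)
  finally show ?case
    using Suc by (simp add: T_def A_def add_ac)
qed simp

text \<open>Dropping the nonnegative boundary term left by the telescoping bounds every partial sum
  by \<open>exp 1 * suminf a\<close>, which is Carleman's inequality.\<close>

lemma Carleman_summable:
  fixes a :: "nat \<Rightarrow> real"
  assumes pos: "\<And>k. a k > 0" and sum: "summable a"
  shows "summable (\<lambda>n. exp ((\<Sum>k<Suc n. ln (a k)) / real (Suc n)))"
proof (rule summableI_nonneg_bounded)
  fix N
  have "(\<Sum>n<N. exp ((\<Sum>k<Suc n. ln (a k)) / real (Suc n)))
      \<le> (\<Sum>n<N. exp 1 * ((\<Sum>k<Suc n. (real k + 1) * a k) / ((real n + 1) * (real n + 2))))"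
    using geometric_mean_le[OF pos] by (intro sum_mono)
  also have "\<dots> = exp 1 * ((\<Sum>k<N. a k) - (\<Sum>k<N. (real k + 1) * a k) / (real N + 1))"
    by (simp only: sum_distrib_left[symmetric] sum_weighted_mean_telescope)
  also have "\<dots> \<le> exp 1 * suminf a"
  proof (intro mult_left_mono)
    have "0 \<le> (\<Sum>k<N. (real k + 1) * a k) / (real N + 1)"
      using pos by (intro divide_nonneg_nonneg sum_nonneg mult_nonneg_nonneg) (auto intro: less_imp_le)
    moreover have "(\<Sum>k<N. a k) \<le> suminf a"
      using pos sum by (intro sum_le_suminf) (auto intro: less_imp_le)
    ultimately show "(\<Sum>k<N. a k) - (\<Sum>k<N. (real k + 1) * a k) / (real N + 1) \<le> suminf a"
      by linarith
  qed simp
  finally show "(\<Sum>n<N. exp ((\<Sum>k<Suc n. ln (a k)) / real (Suc n))) \<le> exp 1 * suminf a" .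
qed simp

lemma sum_list_map_upt: "(\<Sum>x\<leftarrow>map a [0..<n]. f x) = (\<Sum>k<n. f (a k))"
  for f :: "'a \<Rightarrow> real"
  by (simp add: interv_sum_list_conv_sum_set_nat atLeast0LessThan o_def)

lemma weak_hardy_mean_ln_linear:
  fixes f :: "real \<Rightarrow> real"
  assumes ln: "\<And>x. 0 < x \<Longrightarrow> x \<le> 1 \<Longrightarrow> f x = ln x"
    and lin: "\<And>x. 1 < x \<Longrightarrow> f x = x - 1"
  shows "weak_hardy_mean {0<..} (quasi_arithmetic_mean {0<..} f)"
proof -
  have int: "is_interval {0::real<..}" by (simp add: is_interval_1)
  note adm = int generator_admissible[of f, OF ln lin]
  have "summable (\<lambda>n. quasi_arithmetic_mean {0<..} f (map a [0..<Suc n]))"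
    if "a \<in> ell1 {0<..}" for a
  proof -
    have sum: "summable a" and pos: "a k > 0" for k using that by (auto simp: ell1_def)
    \<comment> \<open>The excess of \<open>f\<close> over the logarithm is at most x, and these
      excesses have a finite total along a summable sequence.\<close>
    have f_le: "f x \<le> ln x + x" if "x > 0" for x
    proof (cases "x \<le> 1")
      case False
      thus ?thesis using lin[of x] ln_ge_zero[of x] by linarith
    qed (use that ln[of x] in auto)
    \<comment> \<open>Turns an upper bound on \<open>f M\<close> into one on \<open>M\<close>
      without inverting \<open>f\<close>.\<close>
    have le_exp: "x \<le> exp (f x)" if "x > 0" for x
      using that ln[of x] lin[of x] exp_ge_add_one_self[of "x - 1"] by (cases "x \<le> 1") auto
    show ?thesis
    proof (rule summable_comparison_test')
      show "summable (\<lambda>n. exp (suminf a) * exp ((\<Sum>k<Suc n. ln (a k)) / real (Suc n)))"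
        by (intro summable_mult Carleman_summable pos sum)
      fix n
      define M where "M = quasi_arithmetic_mean {0<..} f (map a [0..<Suc n])"
      have M: "M > 0" "f M = (\<Sum>k<Suc n. f (a k)) / real (Suc n)"
        using quasi_arithmetic_mean_between(1,4)[OF adm, of "map a [0..<Suc n]"] pos
        unfolding M_def sum_list_map_upt by auto
      have part: "(\<Sum>k<Suc n. a k) \<le> suminf a" "0 \<le> suminf a"
        using pos sum by (auto intro!: sum_le_suminf suminf_nonneg simp: less_imp_le
            simp del: sum.lessThan_Suc)
      have "(\<Sum>k<Suc n. f (a k)) \<le> (\<Sum>k<Suc n. ln (a k) + a k)"
        using f_le pos by (intro sum_mono) auto
      also have "\<dots> \<le> (\<Sum>k<Suc n. ln (a k)) + suminf a"
        using part(1) by (simp add: sum.distrib del: sum.lessThan_Suc)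
      \<comment> \<open>The crude factor \<open>Suc n\<close> cancels on averaging and leaves the
        multiplier \<open>exp (suminf a)\<close>, which does not depend on \<open>n\<close>.\<close>
      also have "\<dots> \<le> (\<Sum>k<Suc n. ln (a k)) + suminf a * real (Suc n)"
        using mult_left_mono[of 1 "real (Suc n)" "suminf a"] part(2) by linarith
      finally have "f M \<le> ((\<Sum>k<Suc n. ln (a k)) + suminf a * real (Suc n)) / real (Suc n)"
        unfolding M(2) by (rule divide_right_mono) simp
      also have "\<dots> = suminf a + (\<Sum>k<Suc n. ln (a k)) / real (Suc n)"
        by (simp add: add_divide_distrib del: sum.lessThan_Suc of_nat_Suc)
      finally have "f M \<le> suminf a + (\<Sum>k<Suc n. ln (a k)) / real (Suc n)" .
      hence "exp (f M) \<le> exp (suminf a) * exp ((\<Sum>k<Suc n. ln (a k)) / real (Suc n))"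
        by (simp only: exp_add[symmetric] exp_le_cancel_iff)
      thus "norm (quasi_arithmetic_mean {0<..} f (map a [0..<Suc n]))
          \<le> exp (suminf a) * exp ((\<Sum>k<Suc n. ln (a k)) / real (Suc n))"
        using le_exp[OF M(1)] M(1) unfolding M_def[symmetric] by simp
    qed
  qed
  thus ?thesis
    using mean_on_quasi_arithmetic_mean[OF adm] by (simp add: weak_hardy_mean_def)
qed

lemma not_hardy_mean_ln_linear:
  fixes f :: "real \<Rightarrow> real"
  assumes ln: "\<And>x. 0 < x \<Longrightarrow> x \<le> 1 \<Longrightarrow> f x = ln x"
    and lin: "\<And>x. 1 < x \<Longrightarrow> f x = x - 1"
  shows "\<not> hardy_mean {0<..} (quasi_arithmetic_mean {0<..} f)"
proof
  assume "hardy_mean {0<..} (quasi_arithmetic_mean {0<..} f)"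
  then obtain C where C: "\<And>a. a \<in> ell1 {0<..} \<Longrightarrow>
      summable (\<lambda>n. quasi_arithmetic_mean {0<..} f (map a [0..<Suc n]))"
    "\<And>a. a \<in> ell1 {0<..} \<Longrightarrow>
      (\<Sum>n. quasi_arithmetic_mean {0<..} f (map a [0..<Suc n])) \<le> C * (\<Sum>n. a n)"
    by (auto simp: hardy_mean_def)
  have int: "is_interval {0::real<..}" by (simp add: is_interval_1)
  note adm = int generator_admissible[of f, OF ln lin]
  \<comment> \<open>The 2 comes from \<open>suminf a\<close> \<le> 2 (N + 1); the absolute value
    covers a negative \<open>C\<close>.\<close>
  have harm_le: "harm (Suc N) \<le> 2 * \<bar>C\<bar>" for N :: nat
  proof -
    \<comment> \<open>Since f (N + 1) = N and f (1/e) = -1, each term 1/e lowers the sum of the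
      values of \<open>f\<close> by one, and it stays nonnegative up to index \<open>N\<close>. The
      geometric tail keeps the terms positive and summable.\<close>
    define a :: "nat \<Rightarrow> real" where
      "a k = (if k = 0 then real N + 1 else if k \<le> N then exp (- 1) else (1 / 2) ^ k)" for k
    have pos: "a k > 0" for k by (simp add: a_def)
    \<comment> \<open>A termwise majorant of \<open>a\<close> made of three series with sums N, N
      and 2.\<close>
    define b :: "nat \<Rightarrow> real" where
      "b k = (if k = 0 then real N else 0) + (if k \<in> {1..N} then 1 else 0) + (1 / 2) ^ k" for k
    have sums_b: "b sums (real N + real N + 2)"
    proof -
      have "(\<lambda>k::nat. if k = 0 then real N else 0) sums real N"
        using sums_single[of 0 "\<lambda>_. real N"] by simp
      moreover have "(\<lambda>k. if k \<in> {1..N} then 1 else 0) sums real N"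
        using sums_If_finite_set[of "{1..N}" "\<lambda>_. 1::real"] by simp
      moreover have "(\<lambda>k. (1 / 2 :: real) ^ k) sums 2"
        using geometric_sums[of "1 / 2 :: real"] by simp
      ultimately show ?thesis unfolding b_def by (intro sums_add)
    qed
    have ab: "a k \<le> b k" for k
      by (auto simp: a_def b_def intro: add_increasing2)
    have sum: "summable a"
      using ab pos by (intro summable_comparison_test'[OF sums_summable[OF sums_b], of 0])
        (auto simp: less_imp_le)
    have suma: "suminf a \<le> 2 * real N + 2" "0 \<le> suminf a"
      using suminf_le[OF ab sum sums_summable[OF sums_b]] sums_unique[OF sums_b]
        suminf_nonneg[OF sum] pos by (auto simp: less_imp_le)
    have a: "a \<in> ell1 {0<..}" using pos sum by (auto simp: ell1_def)
    let ?M = "\<lambda>n. quasi_arithmetic_mean {0<..} f (map a [0..<Suc n])"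
    have M: "?M n > 0" "f (?M n) = (\<Sum>k<Suc n. f (a k)) / real (Suc n)" for n
      using quasi_arithmetic_mean_between(1,4)[OF adm, of "map a [0..<Suc n]"] pos
      unfolding sum_list_map_upt by auto
    have M_eq: "?M n = (real N + 1) / real (Suc n)" if "n \<le> N" for n
    proof -
      \<comment> \<open>For \<open>N = 0\<close> the first term is 1, which belongs to the
        logarithmic branch.\<close>
      have "f (a 0) = real N" using lin[of "real N + 1"] ln[of 1] by (cases "N = 0") (auto simp: a_def)
      hence "(\<Sum>k<Suc n. f (a k)) = real N + (\<Sum>k<n. f (a (Suc k)))"
        by (simp only: sum.lessThan_Suc_shift)
      also have "(\<Sum>k<n. f (a (Suc k))) = (\<Sum>k<n. - 1)"
        using that ln[of "exp (- 1)"] by (intro sum.cong) (auto simp: a_def)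
      finally have fM: "f (?M n) = (real N + 1) / real (Suc n) - 1"
        unfolding M(2) by (simp add: field_simps)
      \<comment> \<open>The logarithmic branch is negative below 1, so the mean is at least 1, where
        \<open>f\<close> is x - 1 (at 1 both formulas give 0) and can be inverted
        explicitly.\<close>
      have "f (?M n) \<ge> 0" unfolding fM using that by simp
      hence "?M n \<ge> 1" using ln[OF M(1)[of n]] M(1)[of n] by (cases "?M n \<le> 1") auto
      hence "f (?M n) = ?M n - 1" using lin[of "?M n"] ln[of "?M n"] by (cases "?M n = 1") auto
      thus ?thesis using fM by simp
    qed
    have "(real N + 1) * harm (Suc N) = (\<Sum>n<Suc N. ?M n)"
      unfolding harm_def One_nat_def sum.atLeast1_atMost_eq sum_distrib_left
      by (intro sum.cong) (auto simp: M_eq divide_inverse simp del: upt_Suc)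
    \<comment> \<open>The means beyond index \<open>N\<close> are positive and can only increase the
      total.\<close>
    also have "\<dots> \<le> (\<Sum>n. ?M n)"
      using M(1) C(1)[OF a] by (intro sum_le_suminf) (auto simp: less_imp_le simp del: upt_Suc)
    also have "\<dots> \<le> C * suminf a" by (rule C(2)[OF a])
    also have "\<dots> \<le> \<bar>C\<bar> * (2 * (real N + 1))"
      using suma by (intro mult_mono) auto
    finally have "(real N + 1) * harm (Suc N) \<le> (real N + 1) * (2 * \<bar>C\<bar>)"
      by (simp only: mult_ac)
    thus ?thesis by (subst (asm) mult_le_cancel_left_pos) auto
  qed
  have "eventually (\<lambda>n. harm n > 2 * \<bar>C\<bar>) sequentially"
    using harm_at_top by (simp add: filterlim_at_top_dense)
  then obtain n where "\<And>m. m \<ge> n \<Longrightarrow> harm m > 2 * \<bar>C\<bar>"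
    by (auto simp: eventually_sequentially)
  from this[of "Suc n"] harm_le[of n] show False by simp
qed

theorem mainTheorem4:
  fixes f :: "real \<Rightarrow> real"
  assumes "\<And>x. 0 < x \<Longrightarrow> x \<le> 1 \<Longrightarrow> f x = ln x"
    and "\<And>x. 1 < x \<Longrightarrow> f x = x - 1"
  shows "weak_hardy_mean {0<..} (quasi_arithmetic_mean {0<..} f) \<and>
         \<not> hardy_mean {0<..} (quasi_arithmetic_mean {0<..} f)"
  using weak_hardy_mean_ln_linear[of f, OF assms] not_hardy_mean_ln_linear[of f, OF assms] by blast

end
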